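(* Let $n\ge 1$ and let $\mathcal{C}=\langle (r_1(x),(1+v)r_2(x)+vr_3(x))\rangle$ be a cyclic code of length $n$ over $\mathcal{R}=\mathbb{F}_2\times(\mathbb{F}_2+v\mathbb{F}_2)$, where $r_i(x),h_i(x)\in\mathbb{F}_2[x]$ satisfy $x^n-1=r_i(x)h_i(x)$ for all $i\in\{1,2,3\}$, and let $\mathcal{C}^{\perp_H}=\langle(\bar h_1(x),v\bar h_2(x)+(1+v)\bar h_3(x))\rangle$ be its Hermitian dual. Then: (i) $\mathrm{Hull_H}(\mathcal{C})=\langle(\mathrm{lcm}(r_1(x),\bar h_1(x)),(1+v)\,\mathrm{lcm}(r_2(x),\bar h_3(x))+v\,\mathrm{lcm}(r_3(x),\bar h_2(x)))\rangle$, and $$|\mathrm{Hull_H}(\mathcal{C})|=2^{3n-\deg(\mathrm{lcm}(r_1(x),\bar h_1(x)))-\deg(\mathrm{lcm}(r_2(x),\bar h_3(x)))-\deg(\mathrm{lcm}(r_3(x),\bar h_2(x)))}.$$ (ii) $\mathrm{Sum_H}(\mathcal{C})=\langle(\gcd(r_1(x),\bar h_1(x)),(1+v)\gcd(r_2(x),\bar h_3(x))+v\gcd(r_3(x),\bar h_2(x)))\rangle$, and $$|\mathrm{Sum_H}(\mathcal{C})|=2^{3n-\deg(\gcd(r_1(x),\bar h_1(x)))-\deg(\gcd(r_2(x),\bar h_3(x)))-\deg(\gcd(r_3(x),\bar h_2(x)))}.$$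
   Context: $\mathcal{R}=\mathbb{F}_2\times(\mathbb{F}_2+v\mathbb{F}_2)=\{(a,b+vc):a,b,c\in\mathbb{F}_2\}$ with $v^2=v$, a commutative ring with componentwise operations. A linear code of length $n$ over $\mathcal{R}$ is an $\mathcal{R}$-submodule of $\mathcal{R}^n$; it is cyclic if it is closed under the cyclic shift $(c_0,\dots,c_{n-1})\mapsto(c_{n-1},c_0,\dots,c_{n-2})$. Identifying $(t_0,\dots,t_{n-1})$ with $t_0+t_1x+\dots+t_{n-1}x^{n-1}$, cyclic codes are the ideals of $\mathcal{R}[x]/\langle \mathbf{1}x^n-\mathbf{1}\rangle$, $\mathbf{1}=(1,1)$. Elements of $\mathcal{R}[x]$ are written $(a(x),b(x)+vc(x))$ with $a,b,c\in\mathbb{F}_2[x]$, and $\langle\cdot\rangle$ denotes the ideal generated in this quotient ring. Conjugation on $\mathcal{R}$: $\overline{(a,b+vc)}=(a,b+c+vc)$. Hermitian inner product on $\mathcal{R}^n$: $\langle\mathbf{t},\mathbf{w}\rangle_H=\sum_i t_i\overline{w_i}$. Hermitian dual: $\mathcal{C}^{\perp_H}=\{\mathbf{t}\in\mathcal{R}^n:\langle\mathbf{t},\mathbf{w}\rangle_H=(0,0)\text{ for all }\mathbf{w}\in\mathcal{C}\}$. $\mathrm{Hull_H}(\mathcal{C})=\mathcal{C}\cap\mathcal{C}^{\perp_H}$ and $\mathrm{Sum_H}(\mathcal{C})=\mathcal{C}+\mathcal{C}^{\perp_H}$. For $h(x)=t_0+t_1x+\dots+t_mx^m\in\mathbb{F}_2[x]$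 with $t_m\neq0$, $\bar h(x)$ denotes its reciprocal polynomial $t_m^{-1}x^mh(1/x)$. *)

theory Defs
  imports
    "HOL-Algebra.Algebraic_Closure_Type"
    "HOL-Algebra.QuotRing"
    "HOL-Library.Product_Plus"
    "HOL-Library.Z2"
    "Jordan_Normal_Form.Matrix"
    "HOL-Computational_Algebra.Computational_Algebra"
begin

text \<open>
  The field with two elements is \<^typ>\<open>bit\<close>. The instances below only serve to make the library's
  \<^const>\<open>gcd\<close> and \<^const>\<open>lcm\<close> (normalised to be monic) available on \<^typ>\<open>bit poly\<close>; they follow the
  library's treatment of the other fields.
\<close>

instantiation bit ::
  "{unique_euclidean_ring, normalization_euclidean_semiring, normalization_semidom_multiplicative}"
begin

definition [simp]: "normalize_bit = (normalize_field :: bit \<Rightarrow> bit)"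
definition [simp]: "unit_factor_bit = (unit_factor_field :: bit \<Rightarrow> bit)"
definition [simp]: "euclidean_size_bit = (euclidean_size_field :: bit \<Rightarrow> nat)"
definition [simp]: "division_segment (x :: bit) = 1"

instance
proof
  fix a b q r :: bit
  show "euclidean_size (a mod b) < euclidean_size b" if "b \<noteq> 0"
    using that by (cases a; cases b) simp_all
  show "euclidean_size a \<le> euclidean_size (a * b)" if "b \<noteq> 0"
    using that by (cases a; cases b) simp_all
  show "(q * b + r) div b = q"
    if "b \<noteq> 0" "division_segment r = division_segment b" "euclidean_size r < euclidean_size b"
    using that by (cases q; cases b; cases r) simp_all
qed (simp_all add: dvd_field_iff split: if_splits)

end

instantiation bit :: euclidean_ring_gcd
begin

definition gcd_bit :: "bit \<Rightarrow> bit \<Rightarrow> bit" where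
  "gcd_bit = Euclidean_Algorithm.gcd"
definition lcm_bit :: "bit \<Rightarrow> bit \<Rightarrow> bit" where
  "lcm_bit = Euclidean_Algorithm.lcm"
definition Gcd_bit :: "bit set \<Rightarrow> bit" where
  "Gcd_bit = Euclidean_Algorithm.Gcd"
definition Lcm_bit :: "bit set \<Rightarrow> bit" where
  "Lcm_bit = Euclidean_Algorithm.Lcm"

instance
  by standard (simp_all add: gcd_bit_def lcm_bit_def Gcd_bit_def Lcm_bit_def)

end

instance bit :: field_gcd ..


text \<open>\<open>F2v b c\<close> stands for $b + vc$, where $v^2 = v$.\<close>

datatype f2v = F2v (f2v_fst: bit) (f2v_snd: bit)

instantiation f2v :: comm_ring_1
begin

definition "0 = F2v 0 0"
definition "1 = F2v 1 0"
definition "x + y = F2v (f2v_fst x + f2v_fst y) (f2v_snd x + f2v_snd y)"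
definition "- x = F2v (- f2v_fst x) (- f2v_snd x)"
definition "x - y = F2v (f2v_fst x - f2v_fst y) (f2v_snd x - f2v_snd y)"
definition "x * y =
  F2v (f2v_fst x * f2v_fst y)
      (f2v_fst x * f2v_snd y + f2v_snd x * f2v_fst y + f2v_snd x * f2v_snd y)"

instance
proof
  note defs = zero_f2v_def one_f2v_def plus_f2v_def uminus_f2v_def minus_f2v_def times_f2v_def
  fix a b c :: f2v
  show "a * b * c = a * (b * c)"
    by (simp only: defs f2v.sel f2v.inject) (simp only: ring_distribs ac_simps simp_thms)
  show "(a + b) * c = a * c + b * c"
    by (simp only: defs f2v.sel f2v.inject) (simp only: ring_distribs ac_simps simp_thms)
  show "a - b = a + - b"
    by (simp only: defs f2v.sel f2v.inject) (simp only: diff_conv_add_uminus simp_thms)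
  show "a + b + c = a + (b + c)" "a + b = b + a" "a * b = b * a"
    by (simp_all only: defs f2v.sel f2v.inject ac_simps simp_thms)
  show "0 + a = a" "- a + a = 0" "1 * a = a"
    by (cases a, simp add: defs)+
  show "(0 :: f2v) \<noteq> 1"
    by (simp add: defs)
qed

end

definition v :: f2v where
  "v = F2v 0 1"

lemma v_idem: "v * v = v"
  by (simp add: v_def times_f2v_def)

lemma F2v_conv: "F2v b c = F2v b 0 + v * F2v c 0"
  by (simp add: v_def times_f2v_def plus_f2v_def)


instantiation prod :: (comm_ring_1, comm_ring_1) comm_ring_1
begin

definition "1 = (1, 1)"
definition "x * y = (fst x * fst y, snd x * snd y)"

instance
  by standard (simp_all add: one_prod_def times_prod_def prod_eq_iff algebra_simps)

end

type_synonym R = "bit \<times> f2v"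

fun conj_R :: "R \<Rightarrow> R" where
  "conj_R (a, F2v b c) = (a, F2v (b + c) c)"


definition linear_code :: "nat \<Rightarrow> R vec set \<Rightarrow> bool" where
  "linear_code n C \<longleftrightarrow> submodule C (ring_of_type_algebra :: R ring) (module_vec TYPE(R) n)"

definition cyclic_shift :: "R vec \<Rightarrow> R vec" where
  "cyclic_shift c = vec (dim_vec c) (\<lambda>i. if i = 0 then c $ (dim_vec c - 1) else c $ (i - 1))"

definition cyclic_code :: "nat \<Rightarrow> R vec set \<Rightarrow> bool" where
  "cyclic_code n C \<longleftrightarrow> linear_code n C \<and> (\<forall>c \<in> C. cyclic_shift c \<in> C)"

definition herm_prod :: "R vec \<Rightarrow> R vec \<Rightarrow> R" where
  "herm_prod t w = t \<bullet> map_vec conj_R w"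

definition herm_dual :: "nat \<Rightarrow> R vec set \<Rightarrow> R vec set" where
  "herm_dual n C = {t \<in> carrier_vec n. \<forall>w \<in> C. herm_prod t w = 0}"

definition herm_hull :: "nat \<Rightarrow> R vec set \<Rightarrow> R vec set" where
  "herm_hull n C = C \<inter> herm_dual n C"

definition herm_sum :: "nat \<Rightarrow> R vec set \<Rightarrow> R vec set" where
  "herm_sum n C = {s + t | s t. s \<in> C \<and> t \<in> herm_dual n C}"


abbreviation Rx :: "R poly ring" where
  "Rx \<equiv> ring_of_type_algebra"

definition xn_ideal :: "nat \<Rightarrow> R poly set" where
  "xn_ideal n = PIdl\<^bsub>Rx\<^esub> (Polynomial.monom 1 n - 1)"

definition quot_class :: "nat \<Rightarrow> R poly \<Rightarrow> R poly set" where
  "quot_class n f = xn_ideal n +>\<^bsub>Rx\<^esub> f"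

definition word_poly :: "R vec \<Rightarrow> R poly" where
  "word_poly t = (\<Sum>i<dim_vec t. Polynomial.monom (t $ i) i)"

text \<open>
  The set of words of length \<open>n\<close> whose polynomials represent the elements of the principal ideal
  that (the class of) \<open>g\<close> generates in the quotient of $R[x]$ by the ideal of $x^n - 1$.
\<close>

definition gen_code :: "nat \<Rightarrow> R poly \<Rightarrow> R vec set" where
  "gen_code n g =
     {t \<in> carrier_vec n. quot_class n (word_poly t) \<in> PIdl\<^bsub>Rx Quot xn_ideal n\<^esub> (quot_class n g)}"

text \<open>
  \<open>pair_poly p q\<close> is the polynomial written $(p(x), q(x))$, i.e. with coefficients $(p_i, q_i)$, and
  \<open>emb\<close> is the inclusion of the binary polynomials.
\<close>

definition pair_poly :: "bit poly \<Rightarrow> f2v poly \<Rightarrow> R poly" where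
  "pair_poly p q = map_poly (\<lambda>a. (a, 0)) p + map_poly (\<lambda>b. (0, b)) q"

definition emb :: "bit poly \<Rightarrow> f2v poly" where
  "emb p = map_poly (\<lambda>b. F2v b 0) p"

lemma coeff_pair_poly: "Polynomial.coeff (pair_poly p q) i = (Polynomial.coeff p i, Polynomial.coeff q i)"
  by (simp add: pair_poly_def coeff_map_poly zero_prod_def)

lemma coeff_emb: "Polynomial.coeff (emb p) i = F2v (Polynomial.coeff p i) 0"
  by (simp add: emb_def coeff_map_poly zero_f2v_def)

text \<open>\<^const>\<open>reflect_poly\<close> maps $h$ of degree $m$ to $x^m h(1/x)$.\<close>

definition recip :: "bit poly \<Rightarrow> bit poly" where
  "recip h = Polynomial.smult (inverse (Polynomial.lead_coeff h)) (reflect_poly h)"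

end

theory Submission
  imports Defs "Jordan_Normal_Form.Char_Poly" "HOL-Library.Cardinality"
begin

text \<open>
  Evaluation at $v = 0$ and $v = 1$ identifies the alphabet with three copies of the binary field.
  A code generated by divisors $g_1, g_2, g_3$ of $x^n - 1$ is then the product of the binary cyclic
  codes of the multiples of the $g_j$ of degree less than $n$. Conjugation swaps the last two
  components, so the Hermitian dual is the product of the Euclidean duals of the component codes with
  the last two exchanged, and the Euclidean dual of the multiples of $r$, where $x^n - 1 = r h$, consists
  of the multiples of the reciprocal of $h$. Intersections and sums become lcms and gcds componentwise.
\<close>

section \<open>Cyclic codes over a field\<close>

text \<open>For deg p < n this is x^(n-1) p(1/x). The monomial pads \<open>reflect_poly\<close>,
  which reverses only up to the actual degree, to the fixed length n.\<close>

definition reversal :: "nat \<Rightarrow> 'a::comm_semiring_1 poly \<Rightarrow> 'a poly" where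
  "reversal n p = Polynomial.monom 1 (n - 1 - Polynomial.degree p) * reflect_poly p"

lemma coeff_reversal:
  assumes "Polynomial.degree p < n"
  shows "Polynomial.coeff (reversal n p) i = (if i < n then Polynomial.coeff p (n - 1 - i) else 0)"
proof -
  consider "i < n - 1 - Polynomial.degree p" | "n - 1 - Polynomial.degree p \<le> i" "i < n" | "n \<le> i"
    by linarith
  then show ?thesis
  proof cases
    case 1
    then show ?thesis
      by (simp add: reversal_def coeff_monom_mult Polynomial.coeff_eq_0)
  next
    case 2
    then have "Polynomial.degree p - (i - (n - 1 - Polynomial.degree p)) = n - 1 - i"
      using assms by linarith
    then show ?thesis
      using 2 assms by (simp add: reversal_def coeff_monom_mult coeff_reflect_poly)
  next
    case 3
    then show ?thesis
      using assms by (simp add: reversal_def coeff_monom_mult coeff_reflect_poly)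
  qed
qed

lemma degree_less_iff_coeff:
  assumes "n \<ge> 1"
  shows "Polynomial.degree p < n \<longleftrightarrow> (\<forall>i\<ge>n. Polynomial.coeff p i = 0)"
proof
  assume "\<forall>i\<ge>n. Polynomial.coeff p i = 0"
  then have "Polynomial.degree p \<le> n - 1"
    using assms by (intro Polynomial.degree_le) auto
  then show "Polynomial.degree p < n"
    using assms by linarith
qed (auto intro: Polynomial.coeff_eq_0)

lemma degree_reversal:
  assumes "Polynomial.degree p < n"
  shows "Polynomial.degree (reversal n p) < n"
  using assms by (subst degree_less_iff_coeff) (auto simp: coeff_reversal)

text \<open>Unlike \<open>reflect_poly\<close>, which loses factors x, the fixed-length reversal is
  an involution.\<close>

lemma reversal_reversal:
  assumes "Polynomial.degree p < n"
  shows "reversal n (reversal n p) = p"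
  using assms degree_reversal[OF assms]
  by (intro Polynomial.poly_eqI) (auto simp: coeff_reversal Polynomial.coeff_eq_0)

text \<open>By multiplicativity of \<open>reflect_poly\<close>, reversal sends multiples of g to
  multiples of \<open>reflect_poly g\<close>. Both operations are involutions here (h has nonzero
  constant term), so the implication can be reversed.\<close>

lemma reflect_poly_dvd_reversal_iff:
  fixes h p :: "'a::field poly"
  assumes "Polynomial.degree p < n" "Polynomial.coeff h 0 \<noteq> 0"
  shows "reflect_poly h dvd p \<longleftrightarrow> h dvd reversal n p"
proof -
  have imp: "reflect_poly g dvd reversal n q" if "g dvd q" for g q :: "'a poly"
    using that by (auto simp: reversal_def reflect_poly_mult)
  show ?thesis
    using imp[of "reflect_poly h" p] imp[of h "reversal n p"] assms
    by (auto simp: reversal_reversal)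
qed

section \<open>The Euclidean dual of a cyclic code\<close>

text \<open>Indices in the convolution add up to n-1, so reversing a pairs equal indices of a and
  w.\<close>

lemma coeff_reversal_mult:
  assumes "Polynomial.degree a < n"
  shows "Polynomial.coeff (reversal n a * w) (n - 1) =
    (\<Sum>i<n. Polynomial.coeff a i * Polynomial.coeff w i)"
proof -
  have "{..n - 1} = {..<n}"
    using assms by auto
  then have "Polynomial.coeff (reversal n a * w) (n - 1) =
      (\<Sum>i<n. Polynomial.coeff a (n - Suc i) * Polynomial.coeff w (n - Suc i))"
    using assms by (simp add: Polynomial.coeff_mult coeff_reversal)
  also have "\<dots> = (\<Sum>i<n. Polynomial.coeff a i * Polynomial.coeff w i)"
    by (rule sum.nat_diff_reindex)
  finally show ?thesis .
qed

lemma degree_monom_minus_1: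
  assumes "n \<ge> 1"
  shows "Polynomial.degree (Polynomial.monom 1 n - 1 :: 'a::comm_ring_1 poly) = n"
proof (rule antisym)
  show "Polynomial.degree (Polynomial.monom 1 n - 1 :: 'a poly) \<le> n"
    by (rule degree_diff_le) (auto simp: Polynomial.degree_monom_le)
  show "n \<le> Polynomial.degree (Polynomial.monom 1 n - 1 :: 'a poly)"
    using assms by (intro Polynomial.le_degree) (simp add: Polynomial.coeff_1)
qed

lemma monom_minus_1_nonzero:
  assumes "n \<ge> 1"
  shows "(Polynomial.monom 1 n - 1 :: 'a::comm_ring_1 poly) \<noteq> 0"
  using degree_monom_minus_1[OF assms, where 'a = 'a] assms by auto

lemma coeff_monom_minus_1_mult:
  fixes m :: "'a::comm_ring_1 poly"
  assumes "i < n"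
  shows "Polynomial.coeff ((Polynomial.monom 1 n - 1) * m) i = - Polynomial.coeff m i"
  using assms by (simp add: left_diff_distrib coeff_monom_mult)

text \<open>The inner product of \<open>a\<close> and \<open>w\<close> is the coefficient of $x^{n-1}$ in \<open>reversal n a * w\<close>.\<close>

lemma cyclic_dual_iff:
  fixes r h a :: "'a::field poly"
  assumes n: "n \<ge> 1" and rh: "Polynomial.monom 1 n - 1 = r * h" and a: "Polynomial.degree a < n"
  shows "(\<forall>w. Polynomial.degree w < n \<longrightarrow> r dvd w \<longrightarrow>
            (\<Sum>i<n. Polynomial.coeff a i * Polynomial.coeff w i) = 0) \<longleftrightarrow> reflect_poly h dvd a"
    (is "?orth \<longleftrightarrow> _")
proof -
  have nz: "r \<noteq> 0" "h \<noteq> 0"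
    using monom_minus_1_nonzero[OF n, where 'a = 'a] rh by auto
  have deg: "Polynomial.degree r + Polynomial.degree h = n"
    using degree_monom_minus_1[OF n, where 'a = 'a] nz rh by (simp add: Polynomial.degree_mult_eq)
  have "Polynomial.coeff (r * h) 0 = -1"
    using n by (simp flip: rh)
  \<comment> \<open>Since x does not divide h, reflecting h twice gives h back.\<close>
  then have h0: "Polynomial.coeff h 0 \<noteq> 0"
    by (auto simp: coeff_mult_0)
  let ?b = "reversal n a"
  have b: "Polynomial.degree ?b < n"
    using a by (rule degree_reversal)
  have "?orth \<longleftrightarrow> h dvd ?b"
  proof
    assume "h dvd ?b"
    then obtain q where q: "?b = h * q" ..
    show ?orth
    proof (intro allI impI)
      fix w assume w: "Polynomial.degree w < n" "r dvd w"
      then obtain s where s: "w = r * s" by blast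
      let ?m = "q * s"
      \<comment> \<open>The product has degree at most 2n-2, so its quotient \<open>?m\<close> by
        x^n - 1 has degree below n-1. Hence the coefficient at n-1 vanishes.\<close>
      have eq: "?b * w = (Polynomial.monom 1 n - 1) * ?m"
        by (simp add: q s rh mult_ac)
      have "Polynomial.coeff ?m (n - 1) = 0"
      proof (cases "?m = 0")
        case False
        have "n + Polynomial.degree ?m = Polynomial.degree (?b * w)"
          unfolding eq using False monom_minus_1_nonzero[OF n, where 'a = 'a]
          by (subst Polynomial.degree_mult_eq) (simp_all add: degree_monom_minus_1[OF n])
        also have "\<dots> \<le> Polynomial.degree ?b + Polynomial.degree w"
          by (rule Polynomial.degree_mult_le)
        finally have "Polynomial.degree ?m < n - 1"
          using w b by linarith
        then show ?thesis
          by (rule Polynomial.coeff_eq_0)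
      qed auto
      then have "Polynomial.coeff (?b * w) (n - 1) = 0"
        unfolding eq using n by (subst coeff_monom_minus_1_mult) auto
      then show "(\<Sum>i<n. Polynomial.coeff a i * Polynomial.coeff w i) = 0"
        by (simp only: coeff_reversal_mult[OF a])
    qed
  next
    assume orth: ?orth
    \<comment> \<open>A nonzero remainder \<rho> of the division by h will be refuted by a single
      codeword.\<close>
    define m \<rho> where "m = ?b div h" and "\<rho> = ?b mod h"
    have b_eq: "?b = h * m + \<rho>"
      by (simp add: m_def \<rho>_def)
    have "\<rho> = 0"
    proof (rule ccontr)
      assume \<rho>: "\<rho> \<noteq> 0"
      then have deg_\<rho>: "Polynomial.degree \<rho> < Polynomial.degree h"
        using nz by (auto simp: \<rho>_def intro: degree_mod_less')
      define k where "k = Polynomial.degree (r * \<rho>)"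
      have k: "k = Polynomial.degree r + Polynomial.degree \<rho>"
        using nz \<rho> by (simp add: k_def Polynomial.degree_mult_eq)
      \<comment> \<open>This shift of r moves the leading coefficient of \<open>r * \<rho>\<close>
        from k to n-1, where the inner product is read off. As deg \<rho> < deg h, k is at most n-1
        and the subtraction is exact.\<close>
      let ?w = "r * Polynomial.monom 1 (n - 1 - k)"
      have "Polynomial.degree ?w < n"
        using nz deg deg_\<rho> by (simp add: Polynomial.degree_mult_eq k Polynomial.degree_monom_eq)
      with orth have "(\<Sum>i<n. Polynomial.coeff a i * Polynomial.coeff ?w i) = 0"
        by auto
      then have "Polynomial.coeff (?b * ?w) (n - 1) = 0"
        by (simp only: coeff_reversal_mult[OF a])
      moreover have "?b * ?w = Polynomial.monom 1 (n - 1 - k) * (?b * r)"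
        by (simp only: mult_ac)
      ultimately have "Polynomial.coeff (Polynomial.monom 1 (n - 1 - k) * (?b * r)) (n - 1) = 0"
        by (simp only:)
      moreover have "n - 1 - (n - 1 - k) = k" "n - 1 - k \<le> n - 1"
        using k deg deg_\<rho> by linarith+
      ultimately have "Polynomial.coeff (?b * r) k = 0"
        by (simp only: coeff_monom_mult if_True mult_1)
      moreover have "?b * r = (Polynomial.monom 1 n - 1) * m + r * \<rho>"
        by (simp add: b_eq rh algebra_simps)
      \<comment> \<open>For nonzero m, deg m < n - deg h = deg r \<le> k. So the multiple of x^n - 1
        contributes nothing at k and only the leading coefficient of \<open>r * \<rho>\<close>
        remains.\<close>
      moreover have "Polynomial.degree m < k \<or> m = 0"
      proof -
        have "Polynomial.degree m + Polynomial.degree h = Polynomial.degree (m * h)" if "m \<noteq> 0"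
          using that nz by (simp add: Polynomial.degree_mult_eq)
        moreover have "m * h = ?b - \<rho>"
          by (simp add: b_eq algebra_simps)
        moreover have "Polynomial.degree (?b - \<rho>) < n"
          using b deg_\<rho> deg by (intro Polynomial.degree_diff_less) auto
        ultimately show ?thesis
          using k deg by fastforce
      qed
      then have "Polynomial.coeff m k = 0"
        by (auto intro: Polynomial.coeff_eq_0)
      ultimately have "Polynomial.coeff (r * \<rho>) k = 0"
        using k deg deg_\<rho> by (simp add: coeff_monom_minus_1_mult)
      then show False
        using \<rho> nz by (simp add: k_def)
    qed
    then show "h dvd ?b"
      by (simp add: \<rho>_def dvd_eq_mod_eq_0)
  qed
  then show ?thesis
    using reflect_poly_dvd_reversal_iff[OF a h0] by simp
qed

text \<open>Reflection is multiplicative and sends x^n - 1 to its negative, so it preserves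
  factorisations of x^n - 1 up to sign.\<close>

lemma reflect_poly_dvd_monom_minus_1:
  fixes h :: "'a::field poly"
  assumes "n \<ge> 1" "h dvd Polynomial.monom 1 n - 1"
  shows "reflect_poly h dvd Polynomial.monom 1 n - 1"
proof -
  have "reflect_poly (Polynomial.monom 1 n - 1 :: 'a poly) = - (Polynomial.monom 1 n - 1)"
    using assms(1)
    by (intro Polynomial.poly_eqI) (auto simp: coeff_reflect_poly degree_monom_minus_1 Polynomial.coeff_1)
  then show ?thesis
    using assms(2) by (metis dvd_def dvd_minus_iff reflect_poly_mult)
qed

section \<open>Sums of cyclic codes\<close>

text \<open>Bezout splits p into a multiple of r and a multiple of s. Reducing the first modulo x^n
  - 1, which r and s both divide, restores the degree bounds and keeps both divisibilities.\<close>

lemma gcd_code_decompose: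
  fixes r s p :: "'a::field_gcd poly"
  assumes n: "n \<ge> 1" and r: "r dvd Polynomial.monom 1 n - 1" and s: "s dvd Polynomial.monom 1 n - 1"
    and p: "Polynomial.degree p < n" "gcd r s dvd p"
  obtains p1 p2 where "p = p1 + p2" "Polynomial.degree p1 < n" "Polynomial.degree p2 < n"
    "r dvd p1" "s dvd p2"
proof -
  let ?X = "Polynomial.monom 1 n - 1 :: 'a poly"
  obtain q where q: "p = gcd r s * q"
    using p(2) ..
  obtain \<alpha> \<beta> where ab: "gcd r s = \<alpha> * r + \<beta> * s"
    by (metis bezout_coefficients_fst_snd)
  define p1 where "p1 = (\<alpha> * r * q) mod ?X"
  have "p = \<alpha> * r * q + \<beta> * s * q"
    by (simp add: q ab algebra_simps)
  then have "p - p1 = (\<alpha> * r * q) div ?X * ?X + \<beta> * s * q"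
    by (simp add: p1_def minus_mod_eq_div_mult[symmetric])
  then have "s dvd p - p1"
    using s by (simp add: dvd_mult)
  moreover have "r dvd p1"
    using r by (simp add: p1_def dvd_mod)
  moreover have "Polynomial.degree p1 < n"
    using degree_mod_less[OF monom_minus_1_nonzero[OF n], of "\<alpha> * r * q"] n
    by (auto simp: p1_def degree_monom_minus_1)
  moreover from this have "Polynomial.degree (p - p1) < n"
    using p(1) by (intro Polynomial.degree_diff_less)
  ultimately show ?thesis
    using that[of p1 "p - p1"] by simp
qed

section \<open>Cardinality of cyclic codes\<close>

text \<open>Bounding coefficients instead of the degree lets m = 0 describe {0}, which occurs for
  the zero code generated by x^n - 1. The induction peels off the constant coefficient.\<close>

lemma card_polys_coeff_bound:
  "finite {p :: 'a::{finite,zero} poly. \<forall>i\<ge>m. Polynomial.coeff p i = 0} \<and>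
   card {p :: 'a poly. \<forall>i\<ge>m. Polynomial.coeff p i = 0} = CARD('a) ^ m"
proof (induction m)
  case 0
  have "{p :: 'a poly. \<forall>i\<ge>0. Polynomial.coeff p i = 0} = {0}"
    by (auto simp: Polynomial.poly_eq_iff)
  then show ?case
    by simp
next
  case (Suc m)
  let ?S = "\<lambda>m. {p :: 'a poly. \<forall>i\<ge>m. Polynomial.coeff p i = 0}"
  have "?S (Suc m) = (\<lambda>(a, p). pCons a p) ` (UNIV \<times> ?S m)"
  proof (intro equalityI subsetI)
    fix p assume p: "p \<in> ?S (Suc m)"
    obtain a q where q: "p = pCons a q"
      by (cases p)
    have "Polynomial.coeff q i = 0" if "m \<le> i" for i
      using p that by (auto simp: q dest: spec[of _ "Suc i"])
    then show "p \<in> (\<lambda>(a, p). pCons a p) ` (UNIV \<times> ?S m)"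
      by (auto simp: q)
  qed (auto simp: Polynomial.coeff_pCons split: nat.splits)
  moreover have "inj_on (\<lambda>(a, p). pCons a p) (UNIV \<times> ?S m)"
    by (auto simp: inj_on_def)
  ultimately show ?case
    using Suc.IH by (simp add: card_image card_cartesian_product)
qed

text \<open>The quotient by g ranges freely over the polynomials with n - deg g
  coefficients.\<close>

lemma card_multiples:
  fixes g :: "'a::{field,finite} poly"
  assumes n: "n \<ge> 1" and g: "g dvd Polynomial.monom 1 n - 1"
  shows "card {p. Polynomial.degree p < n \<and> g dvd p} = CARD('a) ^ (n - Polynomial.degree g)"
proof -
  let ?d = "n - Polynomial.degree g"
  let ?S = "{p :: 'a poly. \<forall>i\<ge>?d. Polynomial.coeff p i = 0}"
  have g0: "g \<noteq> 0"
    using g monom_minus_1_nonzero[OF n, where 'a = 'a] by auto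
  have dg: "Polynomial.degree g \<le> n"
    using dvd_imp_degree_le[OF g monom_minus_1_nonzero[OF n]] n by (simp add: degree_monom_minus_1)
  have *: "Polynomial.degree (g * q) < n \<longleftrightarrow> q \<in> ?S" for q
  proof (cases "q = 0")
    case False
    then have "Polynomial.degree (g * q) < n \<longleftrightarrow> Polynomial.degree q < ?d"
      using g0 dg by (auto simp: Polynomial.degree_mult_eq)
    also have "\<dots> \<longleftrightarrow> q \<in> ?S"
      using False by (auto intro: Polynomial.coeff_eq_0 simp: not_less[symmetric])
    finally show ?thesis .
  qed (use n in auto)
  have "{p. Polynomial.degree p < n \<and> g dvd p} = (\<lambda>q. g * q) ` ?S"
    using * by (auto elim!: dvdE)
  moreover have "inj_on (\<lambda>q. g * q) ?S"
    using g0 by (auto simp: inj_on_def)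
  ultimately show ?thesis
    using card_polys_coeff_bound[of ?d, where 'a = 'a] by (simp add: card_image)
qed

instance bit :: finite
proof
  have "UNIV = {0, 1 :: bit}"
    by (auto intro: bit.exhaust)
  then show "finite (UNIV :: bit set)"
    by (metis finite.emptyI finite.insertI)
qed

lemma card_bit: "CARD(bit) = 2"
proof -
  have "UNIV = {0, 1 :: bit}"
    by (auto intro: bit.exhaust)
  then show ?thesis
    by (metis card_2_iff zero_neq_one)
qed

section \<open>Splitting the alphabet into three copies of the binary field\<close>

text \<open>\<open>V0\<close> and \<open>V1\<close> are the evaluations of $b + vc$ at $v = 0$ and $v = 1$; conjugation swaps them.\<close>

datatype component = Fst | V0 | V1

lemma UNIV_component: "UNIV = {Fst, V0, V1}"
  using component.exhaust by auto

instance component :: finite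
  by standard (simp add: UNIV_component)

fun proj :: "component \<Rightarrow> R \<Rightarrow> bit" where
  "proj Fst (a, _) = a"
| "proj V0 (_, F2v b c) = b"
| "proj V1 (_, F2v b c) = b + c"

fun conj_component :: "component \<Rightarrow> component" where
  "conj_component Fst = Fst"
| "conj_component V0 = V1"
| "conj_component V1 = V0"

lemma conj_component_conj_component [simp]: "conj_component (conj_component j) = j"
  by (cases j) auto

text \<open>The conjugate (b + c) + vc takes the value b + c at v = 0 and b + c + c = b at v =
  1.\<close>

lemma proj_conj_R: "proj j (conj_R x) = proj (conj_component j) x"
  by (cases "(j, x)" rule: proj.cases; cases "snd x") (auto simp: add.assoc)

lemma R_eq_iff: "x = y \<longleftrightarrow> (\<forall>j. proj j x = proj j y)"
proof
  assume *: "\<forall>j. proj j x = proj j y"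
  obtain a b c a' b' c' where "x = (a, F2v b c)" "y = (a', F2v b' c')"
    by (metis f2v.exhaust surj_pair)
  then show "x = y"
    using *[rule_format, of Fst] *[rule_format, of V0] *[rule_format, of V1]
    by (cases b; cases b'; cases c; cases c') simp_all
qed simp

text \<open>Evaluation is multiplicative because 0 and 1 satisfy the relation v^2 = v.\<close>

interpretation proj: comm_ring_hom "proj j" for j
proof
  fix x y :: R
  obtain a b c a' b' c' where xy: "x = (a, F2v b c)" "y = (a', F2v b' c')"
    by (metis f2v.exhaust surj_pair)
  show "proj j (x + y) = proj j x + proj j y"
    by (cases j; cases b; cases c; cases b'; cases c') (simp_all add: xy plus_prod_def plus_f2v_def)
  show "proj j (x * y) = proj j x * proj j y"
    by (cases j; cases b; cases c; cases b'; cases c') (simp_all add: xy times_prod_def times_f2v_def)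
  show "proj j 1 = 1"
    by (cases j) (simp_all add: one_prod_def one_f2v_def)
  show "proj j 0 = 0"
    by (cases j) (simp_all add: zero_prod_def zero_f2v_def)
qed

interpretation map_proj: map_poly_comm_ring_hom "proj j" for j ..

lemma R_poly_eq_iff: "p = q \<longleftrightarrow> (\<forall>j. map_poly (proj j) p = map_poly (proj j) q)"
  by (auto simp: Polynomial.poly_eq_iff coeff_map_poly R_eq_iff)

text \<open>The orthogonal idempotents 1 + v and v take the values 1, 0 and 0, 1 at v = 0, 1. So
  this is the Chinese remainder inverse of the three projections, in the shape of the generators in
  the theorem.\<close>

definition join_poly :: "(component \<Rightarrow> bit poly) \<Rightarrow> R poly" where
  "join_poly g = pair_poly (g Fst)
     (Polynomial.smult (1 + v) (emb (g V0)) + Polynomial.smult v (emb (g V1)))"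

lemma map_proj_join_poly [simp]: "map_poly (proj j) (join_poly g) = g j"
proof (rule Polynomial.poly_eqI)
  fix i
  have "Polynomial.coeff (join_poly g) i = (Polynomial.coeff (g Fst) i,
      F2v (Polynomial.coeff (g V0) i) (Polynomial.coeff (g V0) i + Polynomial.coeff (g V1) i))"
    by (simp add: join_poly_def coeff_pair_poly coeff_emb v_def one_f2v_def plus_f2v_def times_f2v_def)
  then show "Polynomial.coeff (map_poly (proj j) (join_poly g)) i = Polynomial.coeff (g j) i"
    by (cases j; cases "Polynomial.coeff (g V0) i"; cases "Polynomial.coeff (g V1) i")
      (simp_all add: coeff_map_poly)
qed

section \<open>Words as triples of binary polynomials\<close>

definition word_component :: "component \<Rightarrow> R vec \<Rightarrow> bit poly" where
  "word_component j t = map_poly (proj j) (word_poly t)"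

lemma coeff_word_component:
  assumes "t \<in> carrier_vec n"
  shows "Polynomial.coeff (word_component j t) i = (if i < n then proj j (t $ i) else 0)"
proof -
  have "Polynomial.coeff (word_poly t) i = (if i < n then t $ i else 0)"
    using assms by (auto simp: word_poly_def Polynomial.coeff_sum sum.delta' cong: if_cong)
  then show ?thesis
    by (simp add: word_component_def coeff_map_poly)
qed

lemma degree_word_component:
  assumes "n \<ge> 1" "t \<in> carrier_vec n"
  shows "Polynomial.degree (word_component j t) < n"
  using assms by (subst degree_less_iff_coeff) (auto simp: coeff_word_component)

lemma word_component_inject:
  assumes "t \<in> carrier_vec n" "u \<in> carrier_vec n" "\<And>j. word_component j t = word_component j u"
  shows "t = u"
proof (rule eq_vecI)
  fix i assume "i < dim_vec u"
  then have "i < n"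
    using assms(2) by simp
  then have "proj j (t $ i) = proj j (u $ i)" for j
    using assms(3)[of j] coeff_word_component[OF assms(1), of j i]
      coeff_word_component[OF assms(2), of j i] by simp
  then show "t $ i = u $ i"
    by (simp add: R_eq_iff)
qed (use assms in auto)

text \<open>Together with \<open>word_component_inject\<close>, this lets a word be chosen freely in
  each component.\<close>

lemma word_component_surj:
  assumes "\<And>j. Polynomial.degree (p j) < n"
  obtains t where "t \<in> carrier_vec n" "\<And>j. word_component j t = p j"
proof
  let ?t = "vec n (Polynomial.coeff (join_poly p))"
  show t: "?t \<in> carrier_vec n"
    by simp
  show "word_component j ?t = p j" for j
  proof (rule Polynomial.poly_eqI)
    fix i
    have "proj j (Polynomial.coeff (join_poly p) i) = Polynomial.coeff (p j) i"
      by (metis coeff_map_poly map_proj_join_poly proj.hom_zero)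
    then show "Polynomial.coeff (word_component j ?t) i = Polynomial.coeff (p j) i"
      using assms[of j] by (simp add: coeff_word_component[OF t] Polynomial.coeff_eq_0)
  qed
qed

lemma word_component_add:
  assumes "t \<in> carrier_vec n" "u \<in> carrier_vec n"
  shows "word_component j (t + u) = word_component j t + word_component j u"
  using assms
  by (intro Polynomial.poly_eqI)
    (simp add: coeff_word_component[of _ n] proj.hom_add del: add_bit_eq_xor)

text \<open>Projections are ring homomorphisms permuted by conjugation; this reduces Hermitian
  orthogonality to binary Euclidean orthogonality.\<close>

lemma proj_herm_prod:
  assumes "t \<in> carrier_vec n" "w \<in> carrier_vec n"
  shows "proj j (herm_prod t w) = (\<Sum>i<n. Polynomial.coeff (word_component j t) i *
    Polynomial.coeff (word_component (conj_component j) w) i)"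
  using assms
  by (simp add: herm_prod_def scalar_prod_def proj.hom_sum proj.hom_mult proj_conj_R
      coeff_word_component lessThan_atLeast0)

section \<open>Principal ideals of the quotient ring\<close>

text \<open>Classes coincide exactly when representatives differ by a multiple of x^n - 1, so ideal
  membership becomes a congruence of polynomials.\<close>

lemma quot_class_mem_iff:
  "quot_class n f \<in> PIdl\<^bsub>Rx Quot xn_ideal n\<^esub> (quot_class n g) \<longleftrightarrow>
   (\<exists>k m. f = k * g + m * (Polynomial.monom 1 n - 1))"
proof -
  interpret cring Rx
    by (rule cring_from_type_algebra)
  have simps [simp]: "carrier Rx = UNIV" "monoid.mult Rx = (*)" "add Rx = (+)"
    by (simp_all add: ring_of_type_algebra_def)
  interpret I: ideal "xn_ideal n" Rx
    unfolding xn_ideal_def by (rule cgenideal_ideal) simp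
  have minus: "x \<ominus>\<^bsub>Rx\<^esub> y = x - y" for x y :: "R poly"
    using minus_equality[of "- y" y] by (simp add: a_minus_def ring_of_type_algebra_def)
  have "quot_class n f \<in> PIdl\<^bsub>Rx Quot xn_ideal n\<^esub> (quot_class n g) \<longleftrightarrow>
      (\<exists>k. quot_class n f = quot_class n k \<otimes>\<^bsub>Rx Quot xn_ideal n\<^esub> quot_class n g)"
    by (auto simp: cgenideal_def FactRing_def A_RCOSETS_def' quot_class_def)
  also have "\<dots> \<longleftrightarrow> (\<exists>k. quot_class n f = quot_class n (k * g))"
    by (simp add: quot_class_def FactRing_def I.rcoset_mult_add)
  also have "\<dots> \<longleftrightarrow> (\<exists>k. f - k * g \<in> xn_ideal n)"
    using quotient_eq_iff_same_a_r_cos[OF I.ideal_axioms, of f] by (simp add: quot_class_def minus)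
  also have "\<dots> \<longleftrightarrow> (\<exists>k m. f = k * g + m * (Polynomial.monom 1 n - 1))"
    by (auto simp: xn_ideal_def cgenideal_def diff_eq_eq add.commute)
  finally show ?thesis .
qed

text \<open>Each \<open>g j\<close> divides x^n - 1, so the congruence implies divisibility in every
  component. Conversely, \<open>join_poly\<close> glues the three quotients into one multiplier,
  with m = 0.\<close>

lemma gen_code_iff:
  assumes g: "\<And>j. g j dvd Polynomial.monom 1 n - 1"
  shows "t \<in> gen_code n (join_poly g) \<longleftrightarrow> t \<in> carrier_vec n \<and> (\<forall>j. g j dvd word_component j t)"
proof -
  let ?X = "Polynomial.monom 1 n - 1 :: bit poly"
  have X: "map_poly (proj j) (Polynomial.monom 1 n - 1) = ?X" for j
    by (simp add: map_proj.hom_minus map_poly_monom)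
  have "(\<exists>k m. word_poly t = k * join_poly g + m * (Polynomial.monom 1 n - 1)) \<longleftrightarrow>
      (\<forall>j. g j dvd word_component j t)"
  proof
    assume "\<exists>k m. word_poly t = k * join_poly g + m * (Polynomial.monom 1 n - 1)"
    then obtain k m where eq: "word_poly t = k * join_poly g + m * (Polynomial.monom 1 n - 1)"
      by blast
    have "word_component j t = map_poly (proj j) k * g j + map_poly (proj j) m * ?X" for j
      by (simp add: word_component_def eq map_proj.hom_add map_proj.hom_mult X)
    then show "\<forall>j. g j dvd word_component j t"
      using g by simp
  next
    assume "\<forall>j. g j dvd word_component j t"
    then have "\<forall>j. \<exists>k. word_component j t = k * g j"
      by (metis dvd_def mult.commute)
    then obtain k where "\<And>j. word_component j t = k j * g j"
      by metis
    then have "word_poly t = join_poly k * join_poly g + 0 * (Polynomial.monom 1 n - 1)"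
      by (simp add: R_poly_eq_iff map_proj.hom_mult flip: word_component_def)
    then show "\<exists>k m. word_poly t = k * join_poly g + m * (Polynomial.monom 1 n - 1)"
      by blast
  qed
  then show ?thesis
    by (simp add: gen_code_def quot_class_mem_iff)
qed

text \<open>Taking components is a bijection onto the product of three binary codes, so
  cardinalities multiply.\<close>

lemma card_gen_code:
  assumes n: "n \<ge> 1" and g: "\<And>j. g j dvd Polynomial.monom 1 n - 1"
  shows "card (gen_code n (join_poly g)) = 2 ^ (3 * n - Polynomial.degree (g Fst)
    - Polynomial.degree (g V0) - Polynomial.degree (g V1))"
proof -
  let ?B = "\<lambda>j. {p. Polynomial.degree p < n \<and> g j dvd p}"
  have "bij_betw (\<lambda>t j. word_component j t) (gen_code n (join_poly g)) (\<Pi>\<^sub>E j\<in>UNIV. ?B j)"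
  proof (rule bij_betw_imageI)
    show "inj_on (\<lambda>t j. word_component j t) (gen_code n (join_poly g))"
      by (rule inj_onI) (metis gen_code_iff g word_component_inject)
    show "(\<lambda>t j. word_component j t) ` gen_code n (join_poly g) = (\<Pi>\<^sub>E j\<in>UNIV. ?B j)"
    proof (intro equalityI subsetI)
      fix p assume p: "p \<in> (\<Pi>\<^sub>E j\<in>UNIV. ?B j)"
      then have dp: "\<And>j. Polynomial.degree (p j) < n" "\<And>j. g j dvd p j"
        by (auto simp: PiE_iff)
      then obtain t where "t \<in> carrier_vec n" "\<And>j. word_component j t = p j"
        using word_component_surj by metis
      then show "p \<in> (\<lambda>t j. word_component j t) ` gen_code n (join_poly g)"
        using dp g by (intro image_eqI[of _ _ t]) (auto simp: gen_code_iff)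
    qed (use n g in \<open>auto simp: gen_code_iff degree_word_component\<close>)
  qed
  then have "card (gen_code n (join_poly g)) = (\<Prod>j\<in>UNIV. card (?B j))"
    by (simp add: bij_betw_same_card card_PiE)
  also have "\<dots> = (\<Prod>j\<in>UNIV. 2 ^ (n - Polynomial.degree (g j)))"
    using card_multiples[OF n g] by (simp add: card_bit)
  also have "\<dots> = 2 ^ ((n - Polynomial.degree (g Fst)) + (n - Polynomial.degree (g V0))
      + (n - Polynomial.degree (g V1)))"
    by (simp add: UNIV_component power_add mult_ac)
  also have "(n - Polynomial.degree (g Fst)) + (n - Polynomial.degree (g V0))
      + (n - Polynomial.degree (g V1)) =
      3 * n - Polynomial.degree (g Fst) - Polynomial.degree (g V0) - Polynomial.degree (g V1)"
  proof -
    \<comment> \<open>This bound makes the truncated subtractions exact, so they can be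
      collected.\<close>
    have "Polynomial.degree (g j) \<le> n" for j
      using dvd_imp_degree_le[OF g monom_minus_1_nonzero[OF n]] n by (simp add: degree_monom_minus_1)
    from this[of Fst] this[of V0] this[of V1] show ?thesis
      by linarith
  qed
  finally show ?thesis .
qed

section \<open>Hermitian dual, hull and sum\<close>

text \<open>A binary leading coefficient is 1, except for the zero polynomial, where both sides are
  0.\<close>

lemma recip_eq_reflect_poly: "recip h = reflect_poly h"
  by (cases "Polynomial.lead_coeff h") (auto simp: recip_def)

lemma recip_dvd_monom_minus_1:
  assumes "n \<ge> 1" "h dvd Polynomial.monom 1 n - 1"
  shows "recip h dvd Polynomial.monom 1 n - 1"
  using reflect_poly_dvd_monom_minus_1[OF assms] by (simp add: recip_eq_reflect_poly)

section \<open>The three factorisations of x^n - 1 treated together\<close>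

locale cyclic_factors =
  fixes n :: nat and r h :: "component \<Rightarrow> bit poly"
  assumes n: "n \<ge> 1" and factors: "\<And>j. Polynomial.monom 1 n - 1 = r j * h j"
begin

text \<open>The index is conjugated because component j of a dual word is paired with the conjugate
  component of the code.\<close>

definition dual_gen :: "component \<Rightarrow> bit poly" where
  "dual_gen j = recip (h (conj_component j))"

lemma gens_dvd: "r j dvd Polynomial.monom 1 n - 1" "dual_gen j dvd Polynomial.monom 1 n - 1"
  unfolding dual_gen_def
  by (metis dvd_triv_left factors, metis dvd_triv_right factors n recip_dvd_monom_minus_1)

lemma lcm_gcd_dvd:
  "lcm (r j) (dual_gen j) dvd Polynomial.monom 1 n - 1"
  "gcd (r j) (dual_gen j) dvd Polynomial.monom 1 n - 1"
  using gens_dvd dvd_trans[OF gcd_dvd1] by (blast intro: lcm_least)+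

text \<open>Codeword components vary independently, so orthogonality decouples into three binary
  conditions, each settled by \<open>cyclic_dual_iff\<close>.\<close>

lemma herm_dual_gen_code:
  "herm_dual n (gen_code n (join_poly r)) = gen_code n (join_poly dual_gen)"
proof (rule Set.set_eqI)
  fix t
  let ?C = "gen_code n (join_poly r)"
  let ?ip = "\<lambda>p w :: bit poly. \<Sum>i<n. Polynomial.coeff p i * Polynomial.coeff w i"
  have C_iff: "w \<in> ?C \<longleftrightarrow> w \<in> carrier_vec n \<and> (\<forall>j. r j dvd word_component j w)" for w
    by (rule gen_code_iff) (rule gens_dvd)
  have "(\<forall>w\<in>?C. herm_prod t w = 0) \<longleftrightarrow> (\<forall>j. dual_gen j dvd word_component j t)"
    if t: "t \<in> carrier_vec n"
  proof -
    have "(\<forall>w\<in>?C. herm_prod t w = 0) \<longleftrightarrow>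
        (\<forall>w\<in>?C. \<forall>j. ?ip (word_component j t) (word_component (conj_component j) w) = 0)"
      using t by (intro ball_cong refl) (simp add: C_iff R_eq_iff proj_herm_prod)
    also have "\<dots> \<longleftrightarrow> (\<forall>j. \<forall>w. Polynomial.degree w < n \<longrightarrow> r (conj_component j) dvd w \<longrightarrow>
        ?ip (word_component j t) w = 0)"
    proof (intro iffI allI ballI impI)
      fix j w
      assume *: "\<forall>w\<in>?C. \<forall>j. ?ip (word_component j t) (word_component (conj_component j) w) = 0"
        and w: "Polynomial.degree w < n" "r (conj_component j) dvd w"
      \<comment> \<open>A codeword that is w in one component and 0 in the others isolates the
        condition on w.\<close>
      have "Polynomial.degree (((\<lambda>_. 0)(conj_component j := w)) i) < n" for i
        using w n by simp
      then obtain u where u: "u \<in> carrier_vec n"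
        "\<And>i. word_component i u = ((\<lambda>_. 0)(conj_component j := w)) i"
        using word_component_surj[of "(\<lambda>_. 0)(conj_component j := w)" n] by blast
      then have "u \<in> ?C"
        using w by (simp add: C_iff)
      with * u show "?ip (word_component j t) w = 0"
        by (metis fun_upd_same)
    next
      fix w j
      assume *: "\<forall>j w. Polynomial.degree w < n \<longrightarrow> r (conj_component j) dvd w \<longrightarrow>
          ?ip (word_component j t) w = 0" and "w \<in> ?C"
      then show "?ip (word_component j t) (word_component (conj_component j) w) = 0"
        using degree_word_component[OF n, of w] by (simp add: C_iff)
    qed
    also have "\<dots> \<longleftrightarrow> (\<forall>j. dual_gen j dvd word_component j t)"
      using cyclic_dual_iff[OF n factors degree_word_component[OF n t]]
      by (simp add: dual_gen_def recip_eq_reflect_poly)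
    finally show ?thesis .
  qed
  then show "t \<in> herm_dual n ?C \<longleftrightarrow> t \<in> gen_code n (join_poly dual_gen)"
    by (auto simp: herm_dual_def gen_code_iff[OF gens_dvd(2)])
qed

lemma herm_hull_gen_code:
  "herm_hull n (gen_code n (join_poly r)) = gen_code n (join_poly (\<lambda>j. lcm (r j) (dual_gen j)))"
  by (auto simp: herm_hull_def herm_dual_gen_code gen_code_iff gens_dvd lcm_gcd_dvd)

text \<open>The gcd divides both generators, which gives one inclusion. For the other,
  \<open>gcd_code_decompose\<close> splits each component, and the pieces are reassembled into two
  words.\<close>

lemma herm_sum_gen_code:
  "herm_sum n (gen_code n (join_poly r)) = gen_code n (join_poly (\<lambda>j. gcd (r j) (dual_gen j)))"
proof (intro equalityI subsetI)
  fix t assume "t \<in> herm_sum n (gen_code n (join_poly r))"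
  then obtain s u where su: "t = s + u" "s \<in> carrier_vec n" "u \<in> carrier_vec n"
    "\<And>j. r j dvd word_component j s" "\<And>j. dual_gen j dvd word_component j u"
    by (auto simp: herm_sum_def herm_dual_gen_code gen_code_iff gens_dvd)
  then have "gcd (r j) (dual_gen j) dvd word_component j s + word_component j u" for j
    by (meson dvd_add dvd_trans gcd_dvd1 gcd_dvd2)
  then show "t \<in> gen_code n (join_poly (\<lambda>j. gcd (r j) (dual_gen j)))"
    using su by (simp add: gen_code_iff lcm_gcd_dvd word_component_add[of _ n])
next
  fix t assume "t \<in> gen_code n (join_poly (\<lambda>j. gcd (r j) (dual_gen j)))"
  then have t: "t \<in> carrier_vec n" "\<And>j. gcd (r j) (dual_gen j) dvd word_component j t"
    by (auto simp: gen_code_iff lcm_gcd_dvd)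
  have "\<exists>p1 p2. word_component j t = p1 + p2 \<and> Polynomial.degree p1 < n \<and> Polynomial.degree p2 < n \<and>
      r j dvd p1 \<and> dual_gen j dvd p2" for j
    by (rule gcd_code_decompose[OF n gens_dvd degree_word_component[OF n t(1)] t(2)]) blast
  then obtain p1 p2 where p: "\<And>j. word_component j t = p1 j + p2 j"
    "\<And>j. Polynomial.degree (p1 j) < n" "\<And>j. Polynomial.degree (p2 j) < n"
    "\<And>j. r j dvd p1 j" "\<And>j. dual_gen j dvd p2 j"
    by metis
  obtain s where s: "s \<in> carrier_vec n" "\<And>j. word_component j s = p1 j"
    using word_component_surj[of p1 n] p(2) by blast
  obtain u where u: "u \<in> carrier_vec n" "\<And>j. word_component j u = p2 j"
    using word_component_surj[of p2 n] p(3) by blast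
  have "t = s + u"
    using t s u p(1) by (intro word_component_inject[of _ n]) (auto simp: word_component_add)
  moreover have "s \<in> gen_code n (join_poly r)" "u \<in> gen_code n (join_poly dual_gen)"
    using s u p(4,5) by (simp_all add: gen_code_iff gens_dvd)
  ultimately show "t \<in> herm_sum n (gen_code n (join_poly r))"
    by (auto simp: herm_sum_def herm_dual_gen_code)
qed

end

theorem theorem8:
  fixes n :: nat and r1 r2 r3 h1 h2 h3 :: "bit poly" and C :: "R vec set"
  assumes "n \<ge> 1"
    and "Polynomial.monom 1 n - 1 = r1 * h1"
    and "Polynomial.monom 1 n - 1 = r2 * h2"
    and "Polynomial.monom 1 n - 1 = r3 * h3"
    and "cyclic_code n C"
    and "C = gen_code n (pair_poly r1
           (Polynomial.smult (1 + v) (emb r2) + Polynomial.smult v (emb r3)))"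
  shows "herm_dual n C =
           gen_code n (pair_poly (recip h1)
             (Polynomial.smult v (emb (recip h2)) + Polynomial.smult (1 + v) (emb (recip h3)))) \<and>
         (herm_hull n C =
           gen_code n (pair_poly (lcm r1 (recip h1))
             (Polynomial.smult (1 + v) (emb (lcm r2 (recip h3))) +
              Polynomial.smult v (emb (lcm r3 (recip h2))))) \<and>
          card (herm_hull n C) =
           2 ^ (3 * n - Polynomial.degree (lcm r1 (recip h1))
                      - Polynomial.degree (lcm r2 (recip h3))
                      - Polynomial.degree (lcm r3 (recip h2)))) \<and>
         (herm_sum n C =
           gen_code n (pair_poly (gcd r1 (recip h1))
             (Polynomial.smult (1 + v) (emb (gcd r2 (recip h3))) +
              Polynomial.smult v (emb (gcd r3 (recip h2))))) \<and>
          card (herm_sum n C) =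
           2 ^ (3 * n - Polynomial.degree (gcd r1 (recip h1))
                      - Polynomial.degree (gcd r2 (recip h3))
                      - Polynomial.degree (gcd r3 (recip h2))))"
proof -
  \<comment> \<open>The coefficient of 1 + v is the value at v = 0 and that of v the value at v = 1,
    so index 2 goes to \<open>V0\<close> and index 3 to \<open>V1\<close>.\<close>
  define r where "r = case_component r1 r2 r3"
  define h where "h = case_component h1 h2 h3"
  interpret cyclic_factors n r h
  proof
    show "Polynomial.monom 1 n - 1 = r j * h j" for j
      using assms(2-4) by (cases j) (simp_all add: r_def h_def)
  qed fact
  have C: "C = gen_code n (join_poly r)"
    by (simp add: assms(6) join_poly_def r_def)
  have gens: "r Fst = r1" "r V0 = r2" "r V1 = r3"
    "dual_gen Fst = recip h1" "dual_gen V0 = recip h3" "dual_gen V1 = recip h2"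
    by (simp_all add: dual_gen_def) (simp_all add: r_def h_def)
  note hull = herm_hull_gen_code and sum = herm_sum_gen_code
  note cards = card_gen_code[OF n lcm_gcd_dvd(1)] card_gen_code[OF n lcm_gcd_dvd(2)]
  show ?thesis
    unfolding C hull sum herm_dual_gen_code cards
    \<comment> \<open>Commutativity is for the dual, whose generator is stated with the v-summand
      first.\<close>
    by (simp add: join_poly_def gens add.commute)
qed

end
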